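(* Let $X$ be a path connected, locally path connected topological space and $x_0\in X$. Then $X$ is homotopically path-Hausdorff if and only if $\pi_1^{qtop}(X,x_0)$ is $T_1$.
   Context: $\Omega(X,x_0)$ denotes the space of loops $[0,1]\to X$ based at $x_0$ with the compact-open topology. $\pi_1^{qtop}(X,x_0)$ is the fundamental group $\pi_1(X,x_0)$ endowed with the quotient topology with respect to the map $\pi:\Omega(X,x_0)\to\pi_1(X,x_0)$, $\pi(\alpha)=[\alpha]$. $\mathcal{P}(X,x_0)$ denotes the set of paths $[0,1]\to X$ starting at $x_0$; $\alpha^{-}(t)=\alpha(1-t)$ is the reverse path and $\alpha\cdot\beta$ is concatenation. For a subset $C\subseteq\pi_1(X,x_0)$, the space $X$ is homotopically path-Hausdorff relative to $C$ if for every pair of paths $\alpha,\beta\in\mathcal{P}(X,x_0)$ with $\alpha(1)=\beta(1)$ and $[\alpha\cdot\beta^{-}]\notin C$, there are a partition $0=t_0<t_1<\dots<t_n=1$ and open sets $U_1,\dots,U_n$ of $X$ with $\alpha([t_{i-1},t_i])\subset U_i$ such that if $\gamma:[0,1]\to X$ is another path satisfying $\gamma([t_{i-1},t_i])\subset U_i$ for $1\le i\le n$ and $\gamma(t_i)=\alpha(t_i)$ for $0\le i\le n$, then $[\gamma\cdot\beta^{-}]\notin C$. $X$ is homotopically path-Hausdorff if it is homotopically path-Hausdorff relative to the trivial subgroup $C=1$. *)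

theory Defs
  imports "HOL-Analysis.Analysis" "HOL-Algebra.Group"
begin

text \<open>Maps \<open>[0,1] \<rightarrow> X\<close> are functions on the reals that are \<^const>\<open>extensional\<close> on \<open>{0..1}\<close>,
  so that two paths are equal as soon as they agree on the unit interval.\<close>

definition paths_from :: "'a topology \<Rightarrow> 'a \<Rightarrow> (real \<Rightarrow> 'a) set"
  where "paths_from X x0 = {\<alpha> \<in> extensional {0..1}. pathin X \<alpha> \<and> \<alpha> 0 = x0}"

definition loops_at :: "'a topology \<Rightarrow> 'a \<Rightarrow> (real \<Rightarrow> 'a) set"
  where "loops_at X x0 = {\<alpha> \<in> paths_from X x0. \<alpha> 1 = x0}"

text \<open>The library operations \<open>+++\<close> and \<^const>\<open>reversepath\<close> are restricted to paths in a type of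
  class \<^class>\<open>topological_space\<close>; here paths live in an abstract topology.\<close>

definition path_concat :: "(real \<Rightarrow> 'a) \<Rightarrow> (real \<Rightarrow> 'a) \<Rightarrow> real \<Rightarrow> 'a"  (infixr \<open>\<cdot>\<^sub>p\<close> 75)
  where "\<alpha> \<cdot>\<^sub>p \<beta> =
    restrict (\<lambda>t. if t \<le> 1/2 then \<alpha> (2 * t) else \<beta> (2 * t - 1)) {0..1}"

definition path_reverse :: "(real \<Rightarrow> 'a) \<Rightarrow> real \<Rightarrow> 'a"
  where "path_reverse \<alpha> = restrict (\<lambda>t. \<alpha> (1 - t)) {0..1}"

text \<open>This is what \<^const>\<open>homotopic_paths\<close> unfolds to, for an abstract topology.\<close>

definition path_homotopic :: "'a topology \<Rightarrow> (real \<Rightarrow> 'a) \<Rightarrow> (real \<Rightarrow> 'a) \<Rightarrow> bool"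
  where "path_homotopic X \<alpha> \<beta> \<longleftrightarrow>
    homotopic_with (\<lambda>\<gamma>. \<gamma> 0 = \<alpha> 0 \<and> \<gamma> 1 = \<alpha> 1) (top_of_set {0..1}) X \<alpha> \<beta>"

definition loop_class :: "'a topology \<Rightarrow> 'a \<Rightarrow> (real \<Rightarrow> 'a) \<Rightarrow> (real \<Rightarrow> 'a) set"
  where "loop_class X x0 \<alpha> = {\<beta> \<in> loops_at X x0. path_homotopic X \<alpha> \<beta>}"

text \<open>The product of two classes is written without choosing representatives: the union of the
  classes of all products of representatives, all of which coincide.\<close>

definition fundamental_group :: "'a topology \<Rightarrow> 'a \<Rightarrow> (real \<Rightarrow> 'a) set monoid"
  where "fundamental_group X x0 =
    \<lparr> carrier = loop_class X x0 ` loops_at X x0,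
      mult = (\<lambda>A B. \<Union>\<alpha>\<in>A. \<Union>\<beta>\<in>B. loop_class X x0 (\<alpha> \<cdot>\<^sub>p \<beta>)),
      one = loop_class X x0 (restrict (\<lambda>t. x0) {0..1}) \<rparr>"

definition compact_open_topology :: "'a topology \<Rightarrow> 'b topology \<Rightarrow> ('a \<Rightarrow> 'b) topology"
  where "compact_open_topology Y X = topology_generated_by
    {{f \<in> extensional (topspace Y). continuous_map Y X f \<and> f ` K \<subseteq> U} | K U.
      compactin Y K \<and> openin X U}"

definition loop_space :: "'a topology \<Rightarrow> 'a \<Rightarrow> (real \<Rightarrow> 'a) topology"
  where "loop_space X x0 =
    subtopology (compact_open_topology (top_of_set {0..1}) X) (loops_at X x0)"

definition quotient_topology :: "'a topology \<Rightarrow> ('a \<Rightarrow> 'b) \<Rightarrow> 'b topology"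
  where "quotient_topology T q =
    topology (\<lambda>V. V \<subseteq> q ` topspace T \<and> openin T {x \<in> topspace T. q x \<in> V})"

definition pi1_qtop :: "'a topology \<Rightarrow> 'a \<Rightarrow> (real \<Rightarrow> 'a) set topology"
  where "pi1_qtop X x0 = quotient_topology (loop_space X x0) (loop_class X x0)"

definition homotopically_path_Hausdorff_rel ::
    "'a topology \<Rightarrow> 'a \<Rightarrow> (real \<Rightarrow> 'a) set set \<Rightarrow> bool"
  where "homotopically_path_Hausdorff_rel X x0 C \<longleftrightarrow>
    (\<forall>\<alpha> \<in> paths_from X x0. \<forall>\<beta> \<in> paths_from X x0.
      \<alpha> 1 = \<beta> 1 \<and> loop_class X x0 (\<alpha> \<cdot>\<^sub>p path_reverse \<beta>) \<notin> C \<longrightarrow>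
      (\<exists>(n::nat) (t :: nat \<Rightarrow> real) (U :: nat \<Rightarrow> 'a set).
        t 0 = 0 \<and> t n = 1 \<and> (\<forall>i\<in>{1..n}. t (i - 1) < t i) \<and>
        (\<forall>i\<in>{1..n}. openin X (U i) \<and> \<alpha> ` {t (i - 1)..t i} \<subseteq> U i) \<and>
        (\<forall>\<gamma> \<in> extensional {0..1}.
          pathin X \<gamma> \<and>
          (\<forall>i\<in>{1..n}. \<gamma> ` {t (i - 1)..t i} \<subseteq> U i) \<and>
          (\<forall>i\<in>{0..n}. \<gamma> (t i) = \<alpha> (t i)) \<longrightarrow>
          loop_class X x0 (\<gamma> \<cdot>\<^sub>p path_reverse \<beta>) \<notin> C)))"

definition homotopically_path_Hausdorff :: "'a topology \<Rightarrow> 'a \<Rightarrow> bool"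
  where "homotopically_path_Hausdorff X x0 \<longleftrightarrow>
    homotopically_path_Hausdorff_rel X x0 {\<one>\<^bsub>fundamental_group X x0\<^esub>}"

lemma openin_quotient_topology:
  "openin (quotient_topology T q) V \<longleftrightarrow>
    V \<subseteq> q ` topspace T \<and> openin T {x \<in> topspace T. q x \<in> V}"
proof -
  have "istopology (\<lambda>V. V \<subseteq> q ` topspace T \<and> openin T {x \<in> topspace T. q x \<in> V})"
    unfolding istopology_def
  proof (intro conjI allI impI)
    fix S R
    assume "S \<subseteq> q ` topspace T \<and> openin T {x \<in> topspace T. q x \<in> S}"
      and "R \<subseteq> q ` topspace T \<and> openin T {x \<in> topspace T. q x \<in> R}"
    moreover have "{x \<in> topspace T. q x \<in> S \<inter> R} =
        {x \<in> topspace T. q x \<in> S} \<inter> {x \<in> topspace T. q x \<in> R}"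
      by blast
    ultimately show "S \<inter> R \<subseteq> q ` topspace T" "openin T {x \<in> topspace T. q x \<in> S \<inter> R}"
      by (blast, simp add: openin_Int)
  next
    fix K
    assume K: "\<forall>S\<in>K. S \<subseteq> q ` topspace T \<and> openin T {x \<in> topspace T. q x \<in> S}"
    then show "\<Union>K \<subseteq> q ` topspace T" by blast
    have "openin T (\<Union>S\<in>K. {x \<in> topspace T. q x \<in> S})"
      using K by blast
    moreover have "(\<Union>S\<in>K. {x \<in> topspace T. q x \<in> S}) = {x \<in> topspace T. q x \<in> \<Union>K}"
      by blast
    ultimately show "openin T {x \<in> topspace T. q x \<in> \<Union>K}"
      by simp
  qed
  then show ?thesis
    by (simp add: quotient_topology_def)
qed

lemma topspace_quotient_topology [simp]: "topspace (quotient_topology T q) = q ` topspace T"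
proof
  show "topspace (quotient_topology T q) \<subseteq> q ` topspace T"
    using openin_quotient_topology[of T q] by blast
  have "{x \<in> topspace T. q x \<in> q ` topspace T} = topspace T"
    by blast
  then have "openin (quotient_topology T q) (q ` topspace T)"
    by (simp add: openin_quotient_topology)
  then show "q ` topspace T \<subseteq> topspace (quotient_topology T q)"
    by (rule openin_subset)
qed

lemma quotient_map_quotient_topology: "quotient_map T (quotient_topology T q) q"
  by (auto simp: quotient_map_def openin_quotient_topology)

lemma topspace_compact_open_topology:
  "topspace (compact_open_topology Y X) =
    {f \<in> extensional (topspace Y). continuous_map Y X f}"
proof -
  have "compactin Y {}" "openin X {}" "f ` {} \<subseteq> {}" for f :: "'a \<Rightarrow> 'b"
    by simp_all
  then show ?thesis
    unfolding compact_open_topology_def topology_generated_by_topspace by blast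
qed

lemma topspace_loop_space: "topspace (loop_space X x0) = loops_at X x0"
  by (auto simp: loop_space_def topspace_compact_open_topology loops_at_def paths_from_def
      pathin_def)

lemma topspace_pi1_qtop: "topspace (pi1_qtop X x0) = carrier (fundamental_group X x0)"
  by (simp add: pi1_qtop_def topspace_loop_space fundamental_group_def)

end

theory Submission
  imports Defs
begin

text \<open>Since \<open>\<alpha> \<cdot>\<^sub>p path_reverse \<beta>\<close> is null-homotopic exactly if \<open>\<alpha>\<close> and \<open>\<beta>\<close> are homotopic, the
  quotient topology is \<open>T\<^sub>1\<close> exactly if for every loop \<open>\<beta>\<close> the loops not homotopic to \<open>\<beta>\<close> form an
  open set. If this holds for the constant loop, a compact-open neighbourhood of \<open>\<alpha> \<cdot>\<^sub>p path_reverse \<beta>\<close>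
  yields, on a sufficiently fine uniform partition, the required open sets along \<open>\<alpha>\<close>.
  Conversely, let a partition \<open>t\<close> and open sets \<open>U\<close> witness the path-Hausdorff property for a loop \<open>\<mu>\<close>
  not homotopic to \<open>\<beta>\<close>, and choose path-connected open neighbourhoods \<open>V i\<close> of \<open>\<mu> (t i)\<close> in
  \<open>U i \<inter> U (Suc i)\<close>. A loop that stays in \<open>U i\<close> on the \<open>i\<close>-th piece and passes through \<open>V i\<close> at
  \<open>t i\<close> can be homotoped, by inserting a detour inside \<open>V i\<close> at each \<open>t i\<close>, to a loop that meets
  \<open>\<mu>\<close> at all partition points; hence it is not homotopic to \<open>\<beta>\<close> either.\<close>

section \<open>Paths and homotopies in an abstract topology\<close>

lemma continuous_map_top_of_set_compose:
  assumes "continuous_map (top_of_set C) X K" "continuous_on S a" "\<And>t. t \<in> S \<Longrightarrow> a t \<in> C"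
  shows "continuous_map (top_of_set S) X (\<lambda>t. K (a t))"
proof -
  have "continuous_map (top_of_set S) (top_of_set C) a"
    using assms(2,3) by auto
  from continuous_map_compose[OF this assms(1)] show ?thesis
    by (simp add: o_def)
qed

lemma continuous_map_top_of_set_cases_le:
  fixes p q :: "'b::topological_space \<Rightarrow> real"
  assumes "continuous_on S p" "continuous_on S q"
    and "continuous_map (top_of_set {x \<in> S. p x \<le> q x}) X f"
    and "continuous_map (top_of_set {x \<in> S. q x \<le> p x}) X g"
    and "\<And>x. x \<in> S \<Longrightarrow> p x = q x \<Longrightarrow> f x = g x"
  shows "continuous_map (top_of_set S) X (\<lambda>x. if p x \<le> q x then f x else g x)"
proof (rule continuous_map_cases_le)
  have "S \<inter> {x \<in> S. R x} = {x \<in> S. R x}" for R by blast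
  then show "continuous_map (subtopology (top_of_set S) {x \<in> topspace (top_of_set S). p x \<le> q x}) X f"
    "continuous_map (subtopology (top_of_set S) {x \<in> topspace (top_of_set S). q x \<le> p x}) X g"
    using assms(3,4) by (simp_all add: subtopology_subtopology)
qed (use assms in auto)

text \<open>The condition on the intermediate paths only sees their values at 0 and 1, so the
  boundary equations need only hold on the unit interval. The bound \<open>t\<close> is position
  along the path in the first two equations and homotopy time in the last two.\<close>

lemma path_homotopic_iff:
  "path_homotopic X \<alpha> \<beta> \<longleftrightarrow>
    (\<exists>H. continuous_map (top_of_set ({0..1} \<times> {0..1})) X H \<and>
      (\<forall>t\<in>{0..1}. H (0, t) = \<alpha> t \<and> H (1, t) = \<beta> t \<and> H (t, 0) = \<alpha> 0 \<and> H (t, 1) = \<alpha> 1))"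
  unfolding path_homotopic_def
  by (subst homotopic_with) (auto simp: Ball_def)

lemma path_homotopic_refl: "pathin X \<alpha> \<Longrightarrow> path_homotopic X \<alpha> \<alpha>"
  by (simp add: path_homotopic_def pathin_def)

lemma path_homotopic_endpoints:
  assumes "path_homotopic X \<alpha> \<beta>"
  shows "\<beta> 0 = \<alpha> 0" "\<beta> 1 = \<alpha> 1"
  using homotopic_with_imp_property[OF assms[unfolded path_homotopic_def]] by blast+

lemma path_homotopic_imp_pathin:
  assumes "path_homotopic X \<alpha> \<beta>"
  shows "pathin X \<alpha>" "pathin X \<beta>"
  using homotopic_with_imp_continuous_maps[OF assms[unfolded path_homotopic_def]]
  unfolding pathin_def by blast+

lemma path_homotopic_sym:
  assumes "path_homotopic X \<alpha> \<beta>"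
  shows "path_homotopic X \<beta> \<alpha>"
  using homotopic_with_symD[OF assms[unfolded path_homotopic_def]]
  unfolding path_homotopic_def path_homotopic_endpoints[OF assms] .

lemma path_homotopic_trans:
  assumes "path_homotopic X \<alpha> \<beta>" "path_homotopic X \<beta> \<gamma>"
  shows "path_homotopic X \<alpha> \<gamma>"
  using homotopic_with_trans[OF assms[unfolded path_homotopic_def
      path_homotopic_endpoints[OF assms(1)]]]
  unfolding path_homotopic_def .

text \<open>The straight-line homotopy from \<open>a\<close> to \<open>b\<close> stays in the convex
  set \<open>C\<close>; composing it with \<open>K\<close> gives the homotopy. Most homotopies below
  are thereby reduced to choosing two curves in an interval or a square.\<close>

lemma path_homotopic_through_convex:
  fixes K :: "'b::real_normed_vector \<Rightarrow> 'a"
  assumes "convex C" "continuous_map (top_of_set C) X K"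
    and a: "continuous_on {0..1} a" "\<And>t. t \<in> {0..1} \<Longrightarrow> a t \<in> C"
    and b: "continuous_on {0..1} b" "\<And>t. t \<in> {0..1} \<Longrightarrow> b t \<in> C"
    and "a 0 = b 0" "a 1 = b 1"
    and f: "\<And>t. t \<in> {0..1} \<Longrightarrow> f t = K (a t)"
    and g: "\<And>t. t \<in> {0..1} \<Longrightarrow> g t = K (b t)"
  shows "path_homotopic X f g"
  unfolding path_homotopic_iff
proof (intro exI conjI)
  let ?h = "\<lambda>z. (1 - fst z) *\<^sub>R a (snd z) + fst z *\<^sub>R b (snd z)"
  show "continuous_map (top_of_set ({0..1} \<times> {0..1})) X (\<lambda>z. K (?h z))"
  proof (rule continuous_map_top_of_set_compose[OF assms(2)])
    show "continuous_on ({0..1} \<times> {0..1}) ?h"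
      by (intro continuous_intros continuous_on_compose2[OF a(1)] continuous_on_compose2[OF b(1)]) auto
    show "?h z \<in> C" if "z \<in> {0..1} \<times> {0..1}" for z
      using that by (auto intro!: convexD[OF \<open>convex C\<close>] a b)
  qed
  have "(1 - t) *\<^sub>R x + t *\<^sub>R x = x" for x :: 'b and t :: real
    by (simp add: algebra_simps)
  then show "\<forall>t\<in>{0..1}. K (?h (0, t)) = f t \<and> K (?h (1, t)) = g t \<and>
      K (?h (t, 0)) = f 0 \<and> K (?h (t, 1)) = f 1"
    using assms(7,8) by (simp add: f g)
qed

section \<open>Concatenation with a reversed path\<close>

lemma path_reverse_apply: "t \<in> {0..1} \<Longrightarrow> path_reverse \<alpha> t = \<alpha> (1 - t)"
  by (simp add: path_reverse_def)

lemma pathin_path_reverse: "pathin X \<alpha> \<Longrightarrow> pathin X (path_reverse \<alpha>)"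
  unfolding pathin_def
  by (rule continuous_map_eq[OF continuous_map_top_of_set_compose[where a="\<lambda>t. 1 - t"]])
    (auto simp: path_reverse_apply intro!: continuous_intros)

lemma path_concat_first: "t \<in> {0..1/2} \<Longrightarrow> (\<alpha> \<cdot>\<^sub>p \<beta>) t = \<alpha> (2 * t)"
  by (simp add: path_concat_def)

lemma path_concat_second: "t \<in> {1/2..1} \<Longrightarrow> \<alpha> 1 = \<beta> 0 \<Longrightarrow> (\<alpha> \<cdot>\<^sub>p \<beta>) t = \<beta> (2 * t - 1)"
proof (cases "t = 1/2")
  case True
  assume "\<alpha> 1 = \<beta> 0"
  then show ?thesis unfolding True by (simp add: path_concat_def)
qed (auto simp: path_concat_def)

text \<open>The given homotopy runs on the left half while the right half stays
  \<open>\<delta>\<close>; the two match at 1/2 because the homotopy fixes endpoints.\<close>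

lemma path_homotopic_concat_left:
  assumes "path_homotopic X \<alpha> \<alpha>'" "pathin X \<delta>" "\<alpha> 1 = \<delta> 0"
  shows "path_homotopic X (\<alpha> \<cdot>\<^sub>p \<delta>) (\<alpha>' \<cdot>\<^sub>p \<delta>)"
proof -
  obtain H where H: "continuous_map (top_of_set ({0..1} \<times> {0..1})) X H"
    and Heq: "\<And>t. t \<in> {0..1} \<Longrightarrow>
      H (0, t) = \<alpha> t \<and> H (1, t) = \<alpha>' t \<and> H (t, 0) = \<alpha> 0 \<and> H (t, 1) = \<alpha> 1"
    using assms(1) unfolding path_homotopic_iff by blast
  let ?L = "\<lambda>z. if snd z \<le> 1/2 then H (fst z, 2 * snd z) else \<delta> (2 * snd z - 1)"
  have "continuous_map (top_of_set ({0..1} \<times> {0..1})) X ?L"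
  proof (rule continuous_map_top_of_set_cases_le)
    show "continuous_map (top_of_set {z \<in> {0..1} \<times> {0..1}. snd z \<le> (1/2::real)}) X
        (\<lambda>z. H (fst z, 2 * snd z))"
      by (rule continuous_map_top_of_set_compose[OF H]) (auto intro!: continuous_intros)
    show "continuous_map (top_of_set {z \<in> {0..1} \<times> {0..1}. 1/2 \<le> (snd z::real)}) X
        (\<lambda>z. \<delta> (2 * snd z - 1))"
      by (rule continuous_map_top_of_set_compose[OF assms(2)[unfolded pathin_def]])
        (auto intro!: continuous_intros)
    show "H (fst z, 2 * snd z) = \<delta> (2 * snd z - 1)"
      if "z \<in> {0..1} \<times> {0..1}" "snd z = 1/2" for z
    proof -
      have "2 * snd z = 1" using that by simp
      then show ?thesis unfolding \<open>2 * snd z = 1\<close> using that Heq[of "fst z"] assms(3) by auto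
    qed
  qed (auto intro!: continuous_intros)
  then show ?thesis
    unfolding path_homotopic_iff
    by (intro exI[of _ ?L]) (use Heq in \<open>auto simp: path_concat_def\<close>)
qed

text \<open>Both ends of a homotopy are continuous, so continuity can be read off from the
  concatenation of a constant homotopy.\<close>

lemma pathin_path_concat:
  "pathin X \<alpha> \<Longrightarrow> pathin X \<beta> \<Longrightarrow> \<alpha> 1 = \<beta> 0 \<Longrightarrow> pathin X (\<alpha> \<cdot>\<^sub>p \<beta>)"
  by (rule path_homotopic_imp_pathin[OF path_homotopic_concat_left[OF path_homotopic_refl]])

text \<open>Both paths factor through \<open>\<alpha>\<close>: one via a tent function on the unit
  interval that vanishes at both ends, the other via the constant 0.\<close>

lemma path_homotopic_concat_reverse_self:
  assumes "pathin X \<alpha>"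
  shows "path_homotopic X (\<alpha> \<cdot>\<^sub>p path_reverse \<alpha>) (restrict (\<lambda>t. \<alpha> 0) {0..1})"
proof (rule path_homotopic_through_convex[OF _ assms[unfolded pathin_def]])
  show "(\<alpha> \<cdot>\<^sub>p path_reverse \<alpha>) t = \<alpha> (1 - \<bar>1 - 2 * t\<bar>)" if "t \<in> {0..1}" for t
    using that by (auto simp: path_concat_def path_reverse_def abs_if)
  show "restrict (\<lambda>t. \<alpha> 0) {0..1} t = \<alpha> 0" if "t \<in> {0..1}" for t :: real
    using that by simp
qed (auto intro!: continuous_intros)

lemma path_homotopic_if_concat_reverse_null:
  assumes "path_homotopic X (\<alpha> \<cdot>\<^sub>p path_reverse \<beta>) (restrict (\<lambda>t. \<alpha> 0) {0..1})"
    and "pathin X \<beta>" "\<beta> 0 = \<alpha> 0" "\<alpha> 1 = \<beta> 1"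
  shows "path_homotopic X \<alpha> \<beta>"
proof -
  let ?c = "\<alpha> \<cdot>\<^sub>p path_reverse \<beta>"
  obtain K where K: "continuous_map (top_of_set ({0..1} \<times> {0..1})) X K"
    and Keq: "\<And>t. t \<in> {0..1} \<Longrightarrow>
      K (0, t) = ?c t \<and> K (1, t) = \<alpha> 0 \<and> K (t, 0) = ?c 0 \<and> K (t, 1) = ?c 1"
    using assms(1) unfolding path_homotopic_iff by auto
  have c: "?c t = \<alpha> (2 * t)" if "t \<in> {0..1/2}" for t
    using that by (rule path_concat_first)
  have c': "?c t = \<beta> (2 - 2 * t)" if "t \<in> {1/2..1}" for t
    using that assms(4) by (simp add: path_concat_second path_reverse_apply)
  \<comment> \<open>In the square carrying the null-homotopy, \<open>\<alpha>\<close> runs along the first half of the bottom edge;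
    the path \<open>b\<close> reaches the same point along the other three edges, where the homotopy
    is constant, followed by the second half of the bottom edge traversed backwards.\<close>
  define b :: "real \<Rightarrow> real \<times> real" where
    "b t = (max 0 (min 1 (min (6 * t) (3 - 6 * t))), min (max 0 (6 * t - 1)) (min 1 (3/2 - t)))" for t
  \<comment> \<open>Up to time 1/2 the curve \<open>b\<close> is on the three constant edges, so its
    image waits at \<open>\<beta> 0\<close>; afterwards it runs through \<open>\<beta>\<close> at
    double speed.\<close>
  have "path_homotopic X \<alpha> (\<lambda>t. \<beta> (max 0 (2 * t - 1)))"
  proof (rule path_homotopic_through_convex[OF _ K, where a="\<lambda>t. (0, t/2)" and b=b])
    show "continuous_on {0..1} b"
      unfolding b_def by (intro continuous_intros)
    show "b t \<in> {0..1} \<times> {0..1}" if "t \<in> {0..1}" for t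
      using that by (auto simp: b_def)
    show "(0, 0/2) = b 0" "(0, 1/2) = b 1" by (auto simp: b_def)
    show "\<alpha> t = K (0, t/2)" if "t \<in> {0..1}" for t
      using that Keq[of "t/2"] c[of "t/2"] by simp
    show "\<beta> (max 0 (2 * t - 1)) = K (b t)" if t: "t \<in> {0..1}" for t
    proof -
      consider "t \<le> 1/6" | "1/6 \<le> t" "t \<le> 1/3" | "1/3 \<le> t" "t \<le> 1/2" | "1/2 \<le> t"
        by linarith
      then show ?thesis
      proof cases
        case 1
        then have "b t = (6 * t, 0)" using t by (auto simp: b_def)
        then show ?thesis using 1 t Keq[of "6 * t"] c[of 0] assms(3) by simp
      next
        case 2
        then have "b t = (1, 6 * t - 1)" using t by (auto simp: b_def)
        then show ?thesis using 2 t Keq[of "6 * t - 1"] assms(3) by simp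
      next
        case 3
        then have "b t = (3 - 6 * t, 1)" using t by (auto simp: b_def)
        then show ?thesis using 3 t Keq[of "3 - 6 * t"] c'[of 1] by simp
      next
        case 4
        then have "b t = (0, 3/2 - t)" using t by (auto simp: b_def)
        then show ?thesis using 4 t Keq[of "3/2 - t"] c'[of "3/2 - t"] by simp
      qed
    qed
  qed (auto intro!: convex_Times continuous_intros)
  \<comment> \<open>The waiting time is removed by a reparametrisation of the unit interval.\<close>
  moreover have "path_homotopic X (\<lambda>t. \<beta> (max 0 (2 * t - 1))) \<beta>"
    by (rule path_homotopic_through_convex[OF _ assms(2)[unfolded pathin_def],
          where a="\<lambda>t. max 0 (2 * t - 1)" and b="\<lambda>t. t"])
      (auto intro!: continuous_intros)
  ultimately show ?thesis by (rule path_homotopic_trans)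
qed

text \<open>For the forward direction, appending the reverse of \<open>\<beta>\<close> to a homotopy
  from \<open>\<alpha>\<close> to \<open>\<beta>\<close> ends at \<open>\<beta>\<close> followed by
  its own reverse, which is null-homotopic.\<close>

lemma path_homotopic_iff_concat_reverse_null:
  assumes "pathin X \<alpha>" "pathin X \<beta>" "\<beta> 0 = \<alpha> 0" "\<alpha> 1 = \<beta> 1"
  shows "path_homotopic X \<alpha> \<beta> \<longleftrightarrow>
    path_homotopic X (\<alpha> \<cdot>\<^sub>p path_reverse \<beta>) (restrict (\<lambda>t. \<alpha> 0) {0..1})"
proof
  assume "path_homotopic X \<alpha> \<beta>"
  then have "path_homotopic X (\<alpha> \<cdot>\<^sub>p path_reverse \<beta>) (\<beta> \<cdot>\<^sub>p path_reverse \<beta>)"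
    by (rule path_homotopic_concat_left)
      (use assms in \<open>auto simp: path_reverse_apply intro: pathin_path_reverse\<close>)
  with path_homotopic_concat_reverse_self[OF assms(2)] assms(3)
  show "path_homotopic X (\<alpha> \<cdot>\<^sub>p path_reverse \<beta>) (restrict (\<lambda>t. \<alpha> 0) {0..1})"
    using path_homotopic_trans by metis
qed (use assms path_homotopic_if_concat_reverse_null in blast)

section \<open>Loop classes\<close>

text \<open>As a loop, \<open>\<alpha>\<close> lies in its own class, so equal classes put it into
  the class of \<open>\<beta>\<close>; the converse is symmetry and transitivity.\<close>

lemma loop_class_eq_iff:
  assumes "\<alpha> \<in> loops_at X x0"
  shows "loop_class X x0 \<alpha> = loop_class X x0 \<beta> \<longleftrightarrow> path_homotopic X \<alpha> \<beta>"
proof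
  have "pathin X \<alpha>" using assms by (auto simp: loops_at_def paths_from_def)
  then have "\<alpha> \<in> loop_class X x0 \<alpha>"
    using assms by (simp add: loop_class_def path_homotopic_refl)
  moreover assume "loop_class X x0 \<alpha> = loop_class X x0 \<beta>"
  ultimately have "\<alpha> \<in> loop_class X x0 \<beta>" by simp
  then show "path_homotopic X \<alpha> \<beta>"
    by (simp add: loop_class_def path_homotopic_sym)
next
  assume "path_homotopic X \<alpha> \<beta>"
  then show "loop_class X x0 \<alpha> = loop_class X x0 \<beta>"
    by (auto simp: loop_class_def intro: path_homotopic_trans path_homotopic_sym)
qed

lemma path_concat_reverse_in_loops_at:
  assumes "\<alpha> \<in> paths_from X x0" "\<beta> \<in> paths_from X x0" "\<alpha> 1 = \<beta> 1"
  shows "\<alpha> \<cdot>\<^sub>p path_reverse \<beta> \<in> loops_at X x0"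
proof -
  have "pathin X (\<alpha> \<cdot>\<^sub>p path_reverse \<beta>)"
    by (rule pathin_path_concat)
      (use assms in \<open>auto simp: paths_from_def path_reverse_apply intro: pathin_path_reverse\<close>)
  moreover have "\<alpha> \<cdot>\<^sub>p path_reverse \<beta> \<in> extensional {0..1}"
    by (simp add: path_concat_def)
  ultimately show ?thesis
    using assms by (simp add: loops_at_def paths_from_def path_concat_def path_reverse_def)
qed

text \<open>Translates the group-theoretic condition in the path-Hausdorff property into homotopy of
  two paths with common endpoints.\<close>

lemma loop_class_concat_reverse_eq_one_iff:
  assumes "\<alpha> \<in> paths_from X x0" "\<beta> \<in> paths_from X x0" "\<alpha> 1 = \<beta> 1"
  shows "loop_class X x0 (\<alpha> \<cdot>\<^sub>p path_reverse \<beta>) = \<one>\<^bsub>fundamental_group X x0\<^esub>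
    \<longleftrightarrow> path_homotopic X \<alpha> \<beta>"
proof -
  have "loop_class X x0 (\<alpha> \<cdot>\<^sub>p path_reverse \<beta>) = \<one>\<^bsub>fundamental_group X x0\<^esub>
    \<longleftrightarrow> path_homotopic X (\<alpha> \<cdot>\<^sub>p path_reverse \<beta>) (restrict (\<lambda>t. \<alpha> 0) {0..1})"
    using loop_class_eq_iff[OF path_concat_reverse_in_loops_at[OF assms]] assms(1)
    by (simp add: fundamental_group_def paths_from_def)
  then show ?thesis
    using path_homotopic_iff_concat_reverse_null[of X \<alpha> \<beta>] assms by (simp add: paths_from_def)
qed

text \<open>Being T1 means that points are closed, and the complement of a point of the quotient is
  open iff its preimage in the loop space is.\<close>

lemma t1_space_pi1_qtop_iff:
  "t1_space (pi1_qtop X x0) \<longleftrightarrow>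
    (\<forall>\<beta>\<in>loops_at X x0. openin (loop_space X x0) {\<alpha> \<in> loops_at X x0. \<not> path_homotopic X \<alpha> \<beta>})"
proof -
  let ?q = "loop_class X x0"
  have "closedin (pi1_qtop X x0) {?q \<beta>} \<longleftrightarrow>
      openin (loop_space X x0) {\<alpha> \<in> loops_at X x0. \<not> path_homotopic X \<alpha> \<beta>}"
    if "\<beta> \<in> loops_at X x0" for \<beta>
  proof -
    have "{\<alpha> \<in> loops_at X x0. ?q \<alpha> \<in> ?q ` loops_at X x0 - {?q \<beta>}} =
        {\<alpha> \<in> loops_at X x0. \<not> path_homotopic X \<alpha> \<beta>}"
      using loop_class_eq_iff[of _ X x0 \<beta>] by auto
    then show ?thesis
      using that by (simp add: closedin_def pi1_qtop_def openin_quotient_topology topspace_loop_space)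
  qed
  then show ?thesis
    unfolding t1_space_closedin_singleton by (simp add: pi1_qtop_def topspace_loop_space)
qed

section \<open>Compact-open neighbourhoods of a path\<close>

lemma openin_loop_space_subbasic:
  assumes "compact K" "K \<subseteq> {0..1}" "openin X U"
  shows "openin (loop_space X x0) {\<alpha> \<in> loops_at X x0. \<alpha> ` K \<subseteq> U}"
proof -
  let ?S = "{f \<in> extensional {0..1}. continuous_map (top_of_set {0..1}) X f \<and> f ` K \<subseteq> U}"
  have "compactin (top_of_set {0..1}) K"
    using assms by (simp add: compactin_subtopology)
  then have "openin (compact_open_topology (top_of_set {0..1}) X) ?S"
    using assms unfolding compact_open_topology_def
    by (intro topology_generated_by_Basis) auto
  moreover have "{\<alpha> \<in> loops_at X x0. \<alpha> ` K \<subseteq> U} = ?S \<inter> loops_at X x0"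
    by (auto simp: loops_at_def paths_from_def pathin_def)
  ultimately show ?thesis
    unfolding loop_space_def openin_subtopology by blast
qed

lemma partition_cover:
  fixes t :: "nat \<Rightarrow> 'b::linorder"
  assumes "0 < n" "t 0 \<le> s" "s \<le> t n"
  shows "\<exists>i\<in>{1..n}. s \<in> {t (i - 1)..t i}"
  using assms
proof (induction n rule: nat_induct_non_zero)
  case (Suc n)
  show ?case
  proof (cases "s \<le> t n")
    case True
    with Suc show ?thesis by fastforce
  next
    case False
    with Suc.prems show ?thesis by (intro bexI[of _ "Suc n"]) auto
  qed
qed auto

text \<open>For open \<open>U i\<close> this is a finite intersection of subbasic compact-open sets,
  one for each cell of the uniform grid. Cells are numbered from 1, as in the path-Hausdorff
  property.\<close>

definition piecewise_in :: "'a topology \<Rightarrow> nat \<Rightarrow> (nat \<Rightarrow> 'a set) \<Rightarrow> (real \<Rightarrow> 'a) set"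
  where "piecewise_in X n U = {g \<in> extensional {0..1}. pathin X g \<and>
    (\<forall>i\<in>{1..n}. g ` {real (i - 1) / n..real i / n} \<subseteq> U i)}"

text \<open>Induction on the generated topology. Asking for all large \<open>n\<close> instead of
  some \<open>n\<close> gives two neighbourhoods a common grid in the intersection case, and later
  allows an even number of cells.\<close>

lemma compact_open_uniform_neighbourhood:
  assumes "openin (compact_open_topology (top_of_set {0..1::real}) X) S" "f \<in> S"
  shows "\<forall>\<^sub>F n in sequentially. \<exists>U. (\<forall>i\<in>{1..n}. openin X (U i)) \<and>
    f \<in> piecewise_in X n U \<and> piecewise_in X n U \<subseteq> S"
proof -
  have f: "f \<in> extensional {0..1}" "pathin X f"
    using openin_subset[OF assms(1)] assms(2)
    by (auto simp: topspace_compact_open_topology pathin_def)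
  show ?thesis
    using assms unfolding compact_open_topology_def openin_topology_generated_by_iff
  proof (induction S rule: generate_topology_on.induct)
    case (Int A B)
    then have "f \<in> A" "f \<in> B" by auto
    from Int.IH(1)[OF this(1)] Int.IH(2)[OF this(2)] show ?case
    proof eventually_elim
      case (elim n)
      then obtain U V where UV: "\<forall>i\<in>{1..n}. openin X (U i)" "\<forall>i\<in>{1..n}. openin X (V i)"
        "f \<in> piecewise_in X n U" "f \<in> piecewise_in X n V"
        "piecewise_in X n U \<subseteq> A" "piecewise_in X n V \<subseteq> B"
        by blast
      \<comment> \<open>Over the same grid, neighbourhoods intersect cell by cell.\<close>
      have "piecewise_in X n (\<lambda>i. U i \<inter> V i) = piecewise_in X n U \<inter> piecewise_in X n V"
        unfolding piecewise_in_def image_subset_iff by blast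
      with UV show ?case
        by (intro exI[of _ "\<lambda>i. U i \<inter> V i"]) (auto intro: openin_Int)
    qed
  next
    case (UN \<K>)
    then obtain A where A: "A \<in> \<K>" "f \<in> A" by blast
    from UN.IH[OF this] show ?case
      by (rule eventually_mono) (use A in blast)
  next
    case (Basis S)
    then obtain K W where S: "S = {f \<in> extensional {0..1}. continuous_map (top_of_set {0..1}) X f \<and> f ` K \<subseteq> W}"
      and "compactin (top_of_set {0..1}) K" and W: "openin X W"
      by auto
    then have K: "compact K" "K \<subseteq> {0..1}" by (auto simp: compactin_subtopology)
    have fK: "f ` K \<subseteq> W" using Basis.prems S by auto
    have "openin (top_of_set {0..1}) {t \<in> topspace (top_of_set {0..1}). f t \<in> W}"
      by (rule openin_continuous_map_preimage[OF f(2)[unfolded pathin_def] W])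
    then obtain B where B: "open B" "{t \<in> {0..1}. f t \<in> W} = {0..1} \<inter> B"
      by (auto simp: openin_open)
    have "K \<subseteq> B" using B(2) K(2) fK by blast
    \<comment> \<open>By compactness \<open>B\<close> contains an
      \<open>\<epsilon>\<close>-neighbourhood of \<open>K\<close>; a cell shorter than
      \<open>\<epsilon>\<close> that meets \<open>K\<close> is therefore mapped into
      \<open>W\<close> by \<open>f\<close>.\<close>
    then obtain \<epsilon> where \<epsilon>: "\<epsilon> > 0" "(\<Union>x\<in>K. ball x \<epsilon>) \<subseteq> B"
      using compact_subset_open_imp_ball_epsilon_subset[OF K(1) B(1)] by blast
    obtain N where N: "1 / real (Suc N) < \<epsilon>"
      using nat_approx_posE[OF \<epsilon>(1)] by blast
    show ?case
      using eventually_gt_at_top[of N]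
    proof eventually_elim
      case (elim n)
      then have "1 / real n \<le> 1 / real (Suc N)" "n > 0" by (auto intro!: divide_left_mono)
      with N have n: "1 / real n < \<epsilon>" by linarith
      let ?I = "\<lambda>i. {real (i - 1) / n..real i / n}"
      \<comment> \<open>Cells that miss \<open>K\<close> carry no constraint, which the open set
        \<open>topspace X\<close> expresses; every point of \<open>K\<close> lies in a cell labelled
        \<open>W\<close>.\<close>
      let ?U = "\<lambda>i. if ?I i \<inter> K = {} then topspace X else W"
      have I: "?I i \<subseteq> {0..1}" if "i \<in> {1..n}" for i
      proof -
        have "0 \<le> real (i - 1) / n" "real i / n \<le> 1" using that by auto
        then show ?thesis by auto
      qed
      have "f s \<in> ?U i" if "i \<in> {1..n}" "s \<in> ?I i" for i s
      proof (cases "?I i \<inter> K = {}")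
        case True
        have "s \<in> {0..1}" using I that by blast
        then show ?thesis using True path_image_subset_topspace[OF f(2)] by auto
      next
        case False
        then obtain k where k: "k \<in> ?I i" "k \<in> K" by blast
        have "real i / n - real (i - 1) / n = 1 / n"
          using that(1) by (simp add: of_nat_diff field_simps)
        then have "dist k s < \<epsilon>"
          using k(1) that(2) n unfolding dist_real_def atLeastAtMost_iff by linarith
        with k(2) have "s \<in> (\<Union>x\<in>K. ball x \<epsilon>)" by auto
        then have "s \<in> B" using \<epsilon>(2) by blast
        moreover have "s \<in> {0..1}" using I that by blast
        ultimately have "f s \<in> W" using B(2) by blast
        then show ?thesis using False by simp
      qed
      then have "\<forall>i\<in>{1..n}. f ` ?I i \<subseteq> ?U i" by (intro ballI image_subsetI)
      with f have "f \<in> piecewise_in X n ?U"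
        unfolding piecewise_in_def by (intro CollectI conjI)
      moreover have "g \<in> S" if g: "g \<in> piecewise_in X n ?U" for g
      proof -
        have "g k \<in> W" if k: "k \<in> K" for k
        proof -
          have "k \<in> {0..1}" using k K by blast
          then obtain i where i: "i \<in> {1..n}" "k \<in> ?I i"
            using partition_cover[of n "\<lambda>i. real i / n" k] \<open>n > 0\<close> by auto
          then have "g k \<in> ?U i" using g unfolding piecewise_in_def by blast
          moreover have "?I i \<inter> K \<noteq> {}" using i k by blast
          ultimately show ?thesis by metis
        qed
        then show ?thesis using g by (auto simp: S pathin_def piecewise_in_def)
      qed
      ultimately show ?case
        using W by (intro exI[of _ ?U]) auto
    qed
  qed auto
qed

section \<open>Moving a path at the points of a partition\<close>

text \<open>Near time \<open>c\<close> the new path makes a detour along \<open>\<delta>\<close> and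
  back, reaching its tip exactly at \<open>c\<close>. The last conclusion keeps the path inside any
  set that contains the detour and the part of \<open>\<nu>\<close> between \<open>t\<close> and
  \<open>c\<close>.\<close>

lemma path_homotopic_spike:
  assumes \<nu>: "pathin X \<nu>" and \<delta>: "pathin X \<delta>" and "\<delta> 0 = \<nu> c"
    and \<epsilon>: "0 < \<epsilon>" "\<epsilon> \<le> c" "\<epsilon> \<le> 1 - c"
  obtains \<gamma> where "\<gamma> \<in> extensional {0..1}" "path_homotopic X \<nu> \<gamma>" "\<gamma> c = \<delta> 1"
    "\<And>t. t \<in> {0..1} \<Longrightarrow> \<epsilon> \<le> \<bar>t - c\<bar> \<Longrightarrow> \<gamma> t = \<nu> t"
    "\<And>t. t \<in> {0..1} \<Longrightarrow> \<gamma> t \<in> \<nu> ` closed_segment t c \<union> \<delta> ` {0..1}"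
proof -
  \<comment> \<open>\<open>K\<close> restricts to \<open>\<nu>\<close> on the bottom edge of the square and to \<open>\<delta>\<close> on the vertical line
    over \<open>c\<close>; \<open>soft\<close> moves \<open>x\<close> towards \<open>c\<close> by \<open>y\<close>, stopping at \<open>c\<close>.\<close>
  define soft where "soft x y = c + (max (x - c - y) 0 + min (x - c + y) 0)" for x y :: real
  define K where
    "K z = (if \<bar>fst z - c\<bar> \<le> snd z then \<delta> (snd z - \<bar>fst z - c\<bar>) else \<nu> (soft (fst z) (snd z)))" for z
  \<comment> \<open>A tent of height 1 at \<open>c\<close>, supported within distance
    \<open>\<epsilon>\<close>. Its graph has the same endpoints as the bottom edge, since the
    support stays inside the unit interval, and is deformed to that edge inside the square.\<close>
  define h where "h t = max 0 (1 - \<bar>t - c\<bar> / \<epsilon>)" for t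
  define \<gamma> where "\<gamma> = restrict (\<lambda>t. K (t, h t)) {0..1}"
  have soft: "soft x y \<in> closed_segment x c" if "0 \<le> y" for x y
    using that by (auto simp: soft_def closed_segment_eq_real_ivl)
  have seg: "closed_segment x c \<subseteq> {0..1}" if "x \<in> {0..1}" for x
    using that \<epsilon> by (auto simp: closed_segment_eq_real_ivl split: if_splits)
  have h: "0 \<le> h t" "h t \<le> 1" for t
    using \<epsilon> by (auto simp: h_def)
  have K: "continuous_map (top_of_set ({0..1} \<times> {0..1})) X K"
    unfolding K_def
  proof (rule continuous_map_top_of_set_cases_le)
    show "continuous_map (top_of_set {z \<in> {0..1} \<times> {0..1}. \<bar>fst z - c\<bar> \<le> snd z}) X
        (\<lambda>z. \<delta> (snd z - \<bar>fst z - c\<bar>))"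
      by (rule continuous_map_top_of_set_compose[OF \<delta>[unfolded pathin_def]])
        (auto intro!: continuous_intros)
    show "continuous_map (top_of_set {z \<in> {0..1} \<times> {0..1}. snd z \<le> \<bar>fst z - c\<bar>}) X
        (\<lambda>z. \<nu> (soft (fst z) (snd z)))"
    proof (rule continuous_map_top_of_set_compose[OF \<nu>[unfolded pathin_def]])
      show "soft (fst z) (snd z) \<in> {0..1}"
        if "z \<in> {z \<in> {0..1} \<times> {0..1}. snd z \<le> \<bar>fst z - c\<bar>}" for z
        using that by (intro subsetD[OF seg soft]) auto
    qed (auto simp: soft_def intro!: continuous_intros)
    show "\<delta> (snd z - \<bar>fst z - c\<bar>) = \<nu> (soft (fst z) (snd z))" if "\<bar>fst z - c\<bar> = snd z" for z
    proof -
      have "soft (fst z) (snd z) = c" using that by (auto simp: soft_def)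
      then show ?thesis using that assms(3) by simp
    qed
  qed (auto intro!: continuous_intros)
  have K0: "K (t, 0) = \<nu> t" for t
  proof (cases "t = c")
    case False
    then show ?thesis by (auto simp: K_def soft_def max_def min_def)
  qed (simp add: K_def assms(3))
  have h0: "h t = 0" if "\<epsilon> \<le> \<bar>t - c\<bar>" for t
    using that \<epsilon> by (simp add: h_def field_simps max_def)
  show ?thesis
  proof
    show "\<gamma> \<in> extensional {0..1}" by (simp add: \<gamma>_def)
    show "path_homotopic X \<nu> \<gamma>"
    proof (rule path_homotopic_through_convex[OF _ K])
      show "\<nu> t = K (t, 0)" for t by (simp add: K0)
      show "\<gamma> t = K (t, h t)" if "t \<in> {0..1}" for t using that by (simp add: \<gamma>_def)
      show "continuous_on {0..1} (\<lambda>t. (t, h t))"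
        unfolding h_def using \<epsilon> by (intro continuous_intros) auto
      show "(0, 0) = (0, h 0)" "(1, 0) = (1, h 1)"
        using \<epsilon> h0[of 0] h0[of 1] by auto
    qed (auto simp: h intro!: convex_Times continuous_intros)
    show "\<gamma> c = \<delta> 1" using \<epsilon> by (simp add: \<gamma>_def K_def h_def)
    show "\<gamma> t = \<nu> t" if "t \<in> {0..1}" "\<epsilon> \<le> \<bar>t - c\<bar>" for t
      using that by (simp add: \<gamma>_def h0 K0)
    show "\<gamma> t \<in> \<nu> ` closed_segment t c \<union> \<delta> ` {0..1}" if "t \<in> {0..1}" for t
      using that soft[of "h t" t] h[of t] by (auto simp: \<gamma>_def K_def)
  qed
qed

lemma partition_strict_mono:
  fixes t :: "nat \<Rightarrow> 'b::linorder"
  assumes "\<forall>i\<in>{1..n}. t (i - 1) < t i" "i < j" "j \<le> n"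
  shows "t i < t j"
  using assms(2,3)
proof (induction j)
  case (Suc j)
  have "t j < t (Suc j)" using assms(1) Suc.prems by force
  moreover have "t i \<le> t j" using Suc by (cases "i = j") auto
  ultimately show ?case by simp
qed simp

text \<open>The interior partition points are corrected one at a time by a spike running inside
  \<open>V k\<close>. As \<open>V k\<close> lies in both \<open>U k\<close> and
  \<open>U (Suc k)\<close>, the constraints on the two adjoining cells survive.\<close>

lemma path_homotopic_through_points:
  assumes \<nu>: "pathin X \<nu>"
    and t: "t 0 = 0" "t n = 1" "\<forall>i\<in>{1..n}. t (i - 1) < t i"
    and U: "\<forall>i\<in>{1..n}. \<nu> ` {t (i - 1)..t i} \<subseteq> U i"
    and V: "\<forall>i\<in>{1..<n}. path_connectedin X (V i) \<and> V i \<subseteq> U i \<inter> U (Suc i) \<and> \<nu> (t i) \<in> V i \<and> y i \<in> V i"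
    and y: "y 0 = \<nu> 0" "y n = \<nu> 1"
  shows "\<exists>\<gamma>\<in>extensional {0..1}. path_homotopic X \<nu> \<gamma> \<and>
    (\<forall>i\<in>{1..n}. \<gamma> ` {t (i - 1)..t i} \<subseteq> U i) \<and> (\<forall>i\<in>{0..n}. \<gamma> (t i) = y i)"
proof -
  have less: "t i < t j" if "i < j" "j \<le> n" for i j
    using partition_strict_mono[OF t(3)] that by blast
  then have le: "t i \<le> t j" if "i \<le> j" "j \<le> n" for i j
    using that by (cases "i = j") (auto simp: less_imp_le)
  have t01: "t i \<in> {0..1}" if "i \<le> n" for i
    using le[of 0 i] le[of i n] that t by auto
  have seg01: "{t (i - 1)..t i} \<subseteq> {0..1}" if "i \<in> {1..n}" for i
    using t01[of "i - 1"] t01[of i] that by auto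
  \<comment> \<open>Invariant: points of index below \<open>k\<close> are corrected, all others keep
    their value under \<open>\<nu>\<close>, so the next detour can start in \<open>V k\<close>. For
    \<open>k = n\<close> the remaining point is an endpoint, where \<open>y\<close> and
    \<open>\<nu>\<close> agree.\<close>
  have "\<exists>\<gamma>\<in>extensional {0..1}. path_homotopic X \<nu> \<gamma> \<and>
    (\<forall>i\<in>{1..n}. \<gamma> ` {t (i - 1)..t i} \<subseteq> U i) \<and>
    (\<forall>i\<le>n. \<gamma> (t i) = (if i < k then y i else \<nu> (t i)))" if "k \<le> n" for k
    using that
  proof (induction k)
    case 0
    define \<nu>' where "\<nu>' = restrict \<nu> {0..1}"
    have \<nu>': "\<nu>' s = \<nu> s" if "s \<in> {0..1}" for s
      using that by (simp add: \<nu>'_def)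
    have "path_homotopic X \<nu> \<nu>'"
      by (rule path_homotopic_through_convex[OF _ \<nu>[unfolded pathin_def],
            where a="\<lambda>t. t" and b="\<lambda>t. t"]) (simp_all add: \<nu>')
    moreover have "\<nu>' ` {t (i - 1)..t i} = \<nu> ` {t (i - 1)..t i}" if "i \<in> {1..n}" for i
      using seg01[OF that] by (intro image_cong \<nu>') auto
    moreover have "\<nu>' \<in> extensional {0..1}" by (simp add: \<nu>'_def)
    ultimately show ?case
      using U t01 \<nu>' by (intro bexI[of _ \<nu>']) auto
  next
    case (Suc k)
    then obtain \<gamma> where \<gamma>: "\<gamma> \<in> extensional {0..1}" "path_homotopic X \<nu> \<gamma>"
      "\<forall>i\<in>{1..n}. \<gamma> ` {t (i - 1)..t i} \<subseteq> U i"
      "\<forall>i\<le>n. \<gamma> (t i) = (if i < k then y i else \<nu> (t i))"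
      by auto
    show ?case
    proof (cases "k = 0")
      case True
      with \<gamma> y(1) t(1) show ?thesis by (intro bexI[of _ \<gamma>]) auto
    next
      case False
      then have k: "k \<in> {1..<n}" using Suc.prems by auto
      \<comment> \<open>The distance from \<open>t k\<close> to the nearest partition point: the
        spike changes neither other partition points nor cells not adjoining
        \<open>t k\<close>.\<close>
      define \<epsilon> where "\<epsilon> = min (t k - t (k - 1)) (t (Suc k) - t k)"
      have \<epsilon>: "0 < \<epsilon>" "\<epsilon> \<le> t k - t (k - 1)" "\<epsilon> \<le> t (Suc k) - t k"
        using less[of "k - 1" k] less[of k "Suc k"] k by (auto simp: \<epsilon>_def)
      have far: "\<epsilon> \<le> \<bar>s - t k\<bar>" if "s \<le> t (k - 1) \<or> t (Suc k) \<le> s" for s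
        using that \<epsilon> by linarith
      have "\<gamma> (t k) = \<nu> (t k)" using \<gamma>(4) k by simp
      then obtain \<delta> where \<delta>: "pathin X \<delta>" "\<delta> \<in> {0..1} \<rightarrow> V k" "\<delta> 0 = \<gamma> (t k)" "\<delta> 1 = y k"
        using V k unfolding path_connectedin by metis
      have "t (k - 1) \<in> {0..1}" "t (Suc k) \<in> {0..1}"
        using t01[of "k - 1"] t01[of "Suc k"] k by (simp_all add: le_diff_conv)
      then have "\<epsilon> \<le> t k" "\<epsilon> \<le> 1 - t k" using \<epsilon> by auto
      then obtain \<gamma>' where \<gamma>': "\<gamma>' \<in> extensional {0..1}" "path_homotopic X \<gamma> \<gamma>'" "\<gamma>' (t k) = \<delta> 1"
        "\<And>s. s \<in> {0..1} \<Longrightarrow> \<epsilon> \<le> \<bar>s - t k\<bar> \<Longrightarrow> \<gamma>' s = \<gamma> s"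
        "\<And>s. s \<in> {0..1} \<Longrightarrow> \<gamma>' s \<in> \<gamma> ` closed_segment s (t k) \<union> \<delta> ` {0..1}"
        using path_homotopic_spike[OF path_homotopic_imp_pathin(2)[OF \<gamma>(2)] \<delta>(1,3) \<epsilon>(1)] by blast
      have "\<gamma>' s \<in> U i" if i: "i \<in> {1..n}" and s: "s \<in> {t (i - 1)..t i}" for i s
      proof -
        have s01: "s \<in> {0..1}" using seg01 i s by blast
        have \<gamma>s: "\<gamma> s \<in> U i" using \<gamma>(3) i s by blast
        \<comment> \<open>Cell \<open>i\<close> ends at \<open>t i\<close>, so the cells adjoining
          \<open>t k\<close> are \<open>k\<close> and \<open>Suc k\<close>.\<close>
        consider "i < k" | "i = k \<or> i = Suc k" | "Suc k < i" by linarith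
        then show ?thesis
        proof cases
          case 1
          then have "i \<le> k - 1" "k - 1 \<le> n" using k by simp_all
          then have "s \<le> t (k - 1)" using s le[of i "k - 1"] by simp
          then show ?thesis using \<gamma>'(4)[OF s01 far] \<gamma>s by simp
        next
          case 2
          then have "closed_segment s (t k) \<subseteq> {t (i - 1)..t i}"
            using s by (auto simp: closed_segment_eq_real_ivl split: if_splits)
          then have "\<gamma> ` closed_segment s (t k) \<subseteq> U i" using \<gamma>(3) i by blast
          moreover have "\<delta> ` {0..1} \<subseteq> U i" using \<delta>(2) V k 2 by blast
          ultimately show ?thesis using \<gamma>'(5)[OF s01] by blast
        next
          case 3
          then have "Suc k \<le> i - 1" "i - 1 \<le> n" using i by simp_all
          then have "t (Suc k) \<le> s" using s le[of "Suc k" "i - 1"] by simp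
          then show ?thesis using \<gamma>'(4)[OF s01 far] \<gamma>s by simp
        qed
      qed
      moreover have "\<gamma>' (t i) = (if i < Suc k then y i else \<nu> (t i))" if "i \<le> n" for i
      proof (cases "i = k")
        case True
        then show ?thesis using \<gamma>'(3) \<delta>(4) by simp
      next
        case False
        then have "i \<le> k - 1 \<or> Suc k \<le> i" by linarith
        then have "t i \<le> t (k - 1) \<or> t (Suc k) \<le> t i"
          using le[of i "k - 1"] le[of "Suc k" i] that k by (auto simp: le_diff_conv)
        then have "\<gamma>' (t i) = \<gamma> (t i)" using \<gamma>'(4)[OF t01[OF that] far] by blast
        then show ?thesis using \<gamma>(4) that False by auto
      qed
      ultimately show ?thesis
        using \<gamma>'(1) path_homotopic_trans[OF \<gamma>(2) \<gamma>'(2)] by (intro bexI[of _ \<gamma>']) blast+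
    qed
  qed
  from this[of n] obtain \<gamma> where \<gamma>: "\<gamma> \<in> extensional {0..1}" "path_homotopic X \<nu> \<gamma>"
    "\<forall>i\<in>{1..n}. \<gamma> ` {t (i - 1)..t i} \<subseteq> U i"
    "\<forall>i\<le>n. \<gamma> (t i) = (if i < n then y i else \<nu> (t i))"
    by blast
  have "\<gamma> (t i) = y i" if "i \<in> {0..n}" for i
    using that \<gamma>(4) t(2) y(2) by (cases "i = n") auto
  with \<gamma>(1-3) show ?thesis by blast
qed

section \<open>Path-Hausdorffness and separation\<close>

text \<open>Openness for the constant loop \<open>e\<close> gives a grid neighbourhood of the
  concatenation. Its first half, rescaled by 2, constrains the competitor \<open>\<gamma>\<close>;
  its second half holds automatically, as there the path is still the reverse of
  \<open>\<beta>\<close>.\<close>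

lemma homotopically_path_Hausdorff_if_t1:
  assumes "t1_space (pi1_qtop X x0)" "x0 \<in> topspace X"
  shows "homotopically_path_Hausdorff X x0"
  unfolding homotopically_path_Hausdorff_def homotopically_path_Hausdorff_rel_def
proof (intro ballI impI)
  define e where "e = restrict (\<lambda>t. x0) {0..1::real}"
  have "pathin X e"
    unfolding pathin_def e_def
    by (rule continuous_map_eq[where f="\<lambda>t. x0"]) (use assms(2) in auto)
  then have "e \<in> loops_at X x0"
    by (simp add: loops_at_def paths_from_def e_def)
  with assms(1) have "openin (loop_space X x0) {\<alpha> \<in> loops_at X x0. \<not> path_homotopic X \<alpha> e}"
    unfolding t1_space_pi1_qtop_iff by (rule bspec)
  then obtain S where S: "openin (compact_open_topology (top_of_set {0..1}) X) S"
    "{\<alpha> \<in> loops_at X x0. \<not> path_homotopic X \<alpha> e} = S \<inter> loops_at X x0"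
    unfolding loop_space_def openin_subtopology by blast
  \<comment> \<open>\<open>S\<close> is open among all paths and may contain paths that are not
    loops, so the description is restricted to loops.\<close>
  have S_iff: "\<mu> \<in> S \<longleftrightarrow> loop_class X x0 \<mu> \<notin> {\<one>\<^bsub>fundamental_group X x0\<^esub>}"
    if "\<mu> \<in> loops_at X x0" for \<mu>
  proof -
    have "\<mu> \<in> S \<longleftrightarrow> \<not> path_homotopic X \<mu> e"
      using S(2) that by blast
    then show ?thesis
      using loop_class_eq_iff[OF that, of e] by (simp add: fundamental_group_def e_def)
  qed
  fix \<alpha> \<beta>
  assume \<alpha>: "\<alpha> \<in> paths_from X x0" and \<beta>: "\<beta> \<in> paths_from X x0"
    and \<alpha>\<beta>: "\<alpha> 1 = \<beta> 1 \<and> loop_class X x0 (\<alpha> \<cdot>\<^sub>p path_reverse \<beta>) \<notin> {\<one>\<^bsub>fundamental_group X x0\<^esub>}"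
  let ?c = "\<lambda>\<gamma>. \<gamma> \<cdot>\<^sub>p path_reverse \<beta>"
  have "?c \<alpha> \<in> S"
    using S_iff path_concat_reverse_in_loops_at[OF \<alpha> \<beta>] \<alpha>\<beta> by blast
  from compact_open_uniform_neighbourhood[OF S(1) this]
  obtain N where N: "\<forall>n\<ge>N. \<exists>U. (\<forall>i\<in>{1..n}. openin X (U i)) \<and>
    ?c \<alpha> \<in> piecewise_in X n U \<and> piecewise_in X n U \<subseteq> S"
    unfolding eventually_sequentially by blast
  \<comment> \<open>With an even number \<open>2 m\<close> of pieces, the first \<open>m\<close> of them subdivide the half of
    the unit interval on which the concatenation runs along its first path.\<close>
  define m where "m = Suc N"
  have "N \<le> 2 * m" "0 < m" by (simp_all add: m_def)
  with N obtain U where U: "\<forall>i\<in>{1..2 * m}. openin X (U i)"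
    and \<alpha>U: "?c \<alpha> \<in> piecewise_in X (2 * m) U" and US: "piecewise_in X (2 * m) U \<subseteq> S"
    by blast
  have cU: "?c \<alpha> s \<in> U i"
    if "i \<in> {1..2 * m}" "s \<in> {real (i - 1) / real (2 * m)..real i / real (2 * m)}" for i s
    using \<alpha>U that unfolding piecewise_in_def by blast
  \<comment> \<open>Doubling carries cell \<open>i\<close> of the grid with \<open>2 * m\<close>
    cells onto cell \<open>i\<close> of the grid with \<open>m\<close> cells.\<close>
  have le_half: "s \<in> {0..1/2}" "2 * s \<in> {real (i - 1) / m..real i / m}"
    if "i \<in> {1..m}" "s \<in> {real (i - 1) / real (2 * m)..real i / real (2 * m)}" for i s
  proof -
    show s: "2 * s \<in> {real (i - 1) / m..real i / m}"
      using that(2) \<open>0 < m\<close> by (simp add: field_simps)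
    have "0 \<le> real (i - 1) / m" "real i / m \<le> 1" using that \<open>0 < m\<close> by auto
    then show "s \<in> {0..1/2}" using s unfolding atLeastAtMost_iff by linarith
  qed
  have ge_half: "s \<in> {1/2..1}"
    if "i \<in> {1..2 * m}" "i \<notin> {1..m}" "s \<in> {real (i - 1) / real (2 * m)..real i / real (2 * m)}" for i s
  proof -
    have "1/2 \<le> real (i - 1) / real (2 * m)" "real i / real (2 * m) \<le> 1"
      using that \<open>0 < m\<close> by (auto simp: field_simps)
    then show ?thesis using that(3) unfolding atLeastAtMost_iff by linarith
  qed
  show "\<exists>(n::nat) t U. t 0 = 0 \<and> t n = 1 \<and> (\<forall>i\<in>{1..n}. t (i - 1) < t i) \<and>
    (\<forall>i\<in>{1..n}. openin X (U i) \<and> \<alpha> ` {t (i - 1)..t i} \<subseteq> U i) \<and>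
    (\<forall>\<gamma>\<in>extensional {0..1}. pathin X \<gamma> \<and> (\<forall>i\<in>{1..n}. \<gamma> ` {t (i - 1)..t i} \<subseteq> U i) \<and>
      (\<forall>i\<in>{0..n}. \<gamma> (t i) = \<alpha> (t i)) \<longrightarrow>
      loop_class X x0 (?c \<gamma>) \<notin> {\<one>\<^bsub>fundamental_group X x0\<^esub>})"
  proof (intro exI conjI ballI impI)
    show "real 0 / real m = 0" "real m / real m = 1" using \<open>0 < m\<close> by simp_all
    show "real (i - 1) / real m < real i / real m" if "i \<in> {1..m}" for i
      using that by (auto intro!: divide_strict_right_mono)
    show "openin X (U i)" if "i \<in> {1..m}" for i using that U by auto
    show "\<alpha> ` {real (i - 1) / real m..real i / real m} \<subseteq> U i" if i: "i \<in> {1..m}" for i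
    proof
      fix x assume "x \<in> \<alpha> ` {real (i - 1) / real m..real i / real m}"
      then obtain s where s: "s \<in> {real (i - 1) / real m..real i / real m}" "x = \<alpha> s" by blast
      then have s2: "s/2 \<in> {real (i - 1) / real (2 * m)..real i / real (2 * m)}"
        using \<open>0 < m\<close> by (simp add: field_simps)
      then have "x = ?c \<alpha> (s/2)" using path_concat_first[OF le_half(1)[OF i s2], of \<alpha>] s by simp
      moreover have "?c \<alpha> (s/2) \<in> U i" using cU[OF _ s2] i by simp
      ultimately show "x \<in> U i" by simp
    qed
    fix \<gamma> :: "real \<Rightarrow> 'a"
    assume "\<gamma> \<in> extensional {0..1}" and *: "pathin X \<gamma> \<and>
      (\<forall>i\<in>{1..m}. \<gamma> ` {real (i - 1) / real m..real i / real m} \<subseteq> U i) \<and>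
      (\<forall>i\<in>{0..m}. \<gamma> (real i / real m) = \<alpha> (real i / real m))"
    \<comment> \<open>Agreement at the first and last partition points gives \<open>\<gamma>\<close>
      the endpoints of \<open>\<alpha>\<close>, so that its concatenation is again a loop.\<close>
    then have "\<gamma> (real 0 / real m) = \<alpha> (real 0 / real m)" "\<gamma> (real m / real m) = \<alpha> (real m / real m)"
      by (meson atLeastAtMost_iff order_refl zero_le)+
    then have \<gamma>: "\<gamma> \<in> paths_from X x0" "\<gamma> 1 = \<alpha> 1"
      using \<alpha> * \<open>\<gamma> \<in> extensional {0..1}\<close> \<open>0 < m\<close> by (simp_all add: paths_from_def)
    then have c\<gamma>: "?c \<gamma> \<in> loops_at X x0"
      using path_concat_reverse_in_loops_at \<beta> \<alpha>\<beta> by metis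
    have "?c \<gamma> \<in> piecewise_in X (2 * m) U"
      unfolding piecewise_in_def
    proof (intro CollectI conjI ballI)
      show "?c \<gamma> \<in> extensional {0..1}" "pathin X (?c \<gamma>)"
        using c\<gamma> by (auto simp: loops_at_def paths_from_def)
      fix i assume i: "i \<in> {1..2 * m}"
      show "?c \<gamma> ` {real (i - 1) / real (2 * m)..real i / real (2 * m)} \<subseteq> U i"
      proof
        fix x assume "x \<in> ?c \<gamma> ` {real (i - 1) / real (2 * m)..real i / real (2 * m)}"
        then obtain s where s: "s \<in> {real (i - 1) / real (2 * m)..real i / real (2 * m)}" "x = ?c \<gamma> s"
          by blast
        show "x \<in> U i"
        proof (cases "i \<in> {1..m}")
          case True
          have "x = \<gamma> (2 * s)" using path_concat_first[OF le_half(1)[OF True s(1)], of \<gamma>] s(2) by simp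
          then show ?thesis using * True le_half(2)[OF True s(1)] by blast
        next
          case False
          have "?c \<gamma> s = ?c \<alpha> s"
            using path_concat_second[OF ge_half[OF i False s(1)], of \<alpha> "path_reverse \<beta>"]
              path_concat_second[OF ge_half[OF i False s(1)], of \<gamma> "path_reverse \<beta>"] \<gamma>(2) \<alpha>\<beta>
            by (simp add: path_reverse_apply)
          then show ?thesis using cU[OF i s(1)] s(2) by simp
        qed
      qed
    qed
    then show "loop_class X x0 (?c \<gamma>) \<notin> {\<one>\<^bsub>fundamental_group X x0\<^esub>}"
      using US S_iff c\<gamma> by blast
  qed
qed

lemma t1_if_homotopically_path_Hausdorff:
  assumes "locally_path_connected_space X" "homotopically_path_Hausdorff X x0"
  shows "t1_space (pi1_qtop X x0)"
  unfolding t1_space_pi1_qtop_iff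
proof
  fix \<beta> assume \<beta>: "\<beta> \<in> loops_at X x0"
  then have \<beta>': "\<beta> \<in> paths_from X x0" "\<beta> 1 = x0" by (auto simp: loops_at_def)
  show "openin (loop_space X x0) {\<alpha> \<in> loops_at X x0. \<not> path_homotopic X \<alpha> \<beta>}"
    unfolding openin_subopen[of _ "{\<alpha> \<in> loops_at X x0. \<not> path_homotopic X \<alpha> \<beta>}"]
  proof
    fix \<mu> assume "\<mu> \<in> {\<alpha> \<in> loops_at X x0. \<not> path_homotopic X \<alpha> \<beta>}"
    then have \<mu>: "\<mu> \<in> loops_at X x0" "\<mu> \<in> paths_from X x0" "\<mu> 1 = \<beta> 1" "\<not> path_homotopic X \<mu> \<beta>"
      using \<beta>' by (auto simp: loops_at_def)
    then have "loop_class X x0 (\<mu> \<cdot>\<^sub>p path_reverse \<beta>) \<notin> {\<one>\<^bsub>fundamental_group X x0\<^esub>}"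
      using loop_class_concat_reverse_eq_one_iff[OF \<mu>(2) \<beta>'(1) \<mu>(3)] by simp
    with \<mu>(3) have \<mu>\<beta>: "\<mu> 1 = \<beta> 1 \<and>
        loop_class X x0 (\<mu> \<cdot>\<^sub>p path_reverse \<beta>) \<notin> {\<one>\<^bsub>fundamental_group X x0\<^esub>}" ..
    \<comment> \<open>\<open>P\<close> names the body of the path-Hausdorff property for
      \<open>\<mu>\<close> and \<open>\<beta>\<close>.\<close>
    define P where "P n t U \<longleftrightarrow> t 0 = 0 \<and> t n = 1 \<and> (\<forall>i\<in>{1..n}. t (i - 1) < t i) \<and>
        (\<forall>i\<in>{1..n}. openin X (U i) \<and> \<mu> ` {t (i - 1)..t i} \<subseteq> U i) \<and>
        (\<forall>\<gamma>\<in>extensional {0..1}. pathin X \<gamma> \<and> (\<forall>i\<in>{1..n}. \<gamma> ` {t (i - 1)..t i} \<subseteq> U i) \<and>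
          (\<forall>i\<in>{0..n}. \<gamma> (t i) = \<mu> (t i)) \<longrightarrow>
          loop_class X x0 (\<gamma> \<cdot>\<^sub>p path_reverse \<beta>) \<notin> {\<one>\<^bsub>fundamental_group X x0\<^esub>})"
      for n :: nat and t U
    have "\<exists>n t U. P n t U"
      unfolding P_def
      by (rule mp[OF bspec[OF bspec[OF assms(2)[unfolded homotopically_path_Hausdorff_def
        homotopically_path_Hausdorff_rel_def] \<mu>(2)] \<beta>'(1)] \<mu>\<beta>])
    then obtain n t U where "P n t U" by blast
    then have t: "t 0 = 0" "t n = 1" "\<forall>i\<in>{1..n}. t (i - 1) < t i"
      and U: "\<forall>i\<in>{1..n}. openin X (U i) \<and> \<mu> ` {t (i - 1)..t i} \<subseteq> U i"
      and *: "\<forall>\<gamma>\<in>extensional {0..1}. pathin X \<gamma> \<and> (\<forall>i\<in>{1..n}. \<gamma> ` {t (i - 1)..t i} \<subseteq> U i) \<and>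
          (\<forall>i\<in>{0..n}. \<gamma> (t i) = \<mu> (t i)) \<longrightarrow>
          loop_class X x0 (\<gamma> \<cdot>\<^sub>p path_reverse \<beta>) \<notin> {\<one>\<^bsub>fundamental_group X x0\<^esub>}"
      unfolding P_def by blast+
    \<comment> \<open>This makes the finite intersection \<open>?O\<close> below range over a
      nonempty index set.\<close>
    have "n \<noteq> 0" using t by (metis zero_neq_one)
    have t01: "t i \<in> {0..1}" if "i \<le> n" for i
      using partition_strict_mono[OF t(3), of 0 i] partition_strict_mono[OF t(3), of i n] that t(1,2)
      by (cases "i = 0 \<or> i = n") (auto simp: less_imp_le)
    \<comment> \<open>The point \<open>t i\<close> belongs to both adjoining cells, so local path
      connectedness applies at \<open>\<mu> (t i)\<close> inside the overlap of their open
      sets.\<close>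
    have "\<exists>W. openin X W \<and> path_connectedin X W \<and> \<mu> (t i) \<in> W \<and> W \<subseteq> U i \<inter> U (Suc i)"
      if i: "i \<in> {1..<n}" for i
    proof -
      have i': "i \<in> {1..n}" "Suc i \<in> {1..n}" using i by auto
      then have "t (i - 1) \<le> t i" "t i \<le> t (Suc i)" using t(3) by force+
      then have "t i \<in> {t (i - 1)..t i}" "t i \<in> {t (Suc i - 1)..t (Suc i)}" by auto
      then have "\<mu> (t i) \<in> U i \<inter> U (Suc i)" "openin X (U i \<inter> U (Suc i))" using U i' by blast+
      then show ?thesis using assms(1) unfolding locally_path_connected_space by blast
    qed
    then obtain V where V: "\<And>i. i \<in> {1..<n} \<Longrightarrow>
        openin X (V i) \<and> path_connectedin X (V i) \<and> \<mu> (t i) \<in> V i \<and> V i \<subseteq> U i \<inter> U (Suc i)"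
      by metis
    let ?A = "\<lambda>i. {\<alpha> \<in> loops_at X x0. \<alpha> ` {t (i - 1)..t i} \<subseteq> U i}"
    \<comment> \<open>The singleton \<open>{t i}\<close> serves as the compact set. No
      \<open>V n\<close> was chosen: at \<open>t n = 1\<close> every loop has the value
      \<open>x0\<close>, and \<open>topspace X\<close> imposes nothing.\<close>
    let ?B = "\<lambda>i. {\<alpha> \<in> loops_at X x0. \<alpha> ` {t i} \<subseteq> (if i < n then V i else topspace X)}"
    let ?O = "(\<Inter>i\<in>{1..n}. ?A i \<inter> ?B i)"
    have "openin (loop_space X x0) ?O"
    proof (rule openin_INT2)
      fix i assume i: "i \<in> {1..n}"
      have "openin (loop_space X x0) (?A i)"
        using U i t01[of "i - 1"] t01[of i] by (intro openin_loop_space_subbasic) auto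
      moreover have "openin (loop_space X x0) (?B i)"
        using V i t01[of i] by (intro openin_loop_space_subbasic) auto
      ultimately show "openin (loop_space X x0) (?A i \<inter> ?B i)" by (rule openin_Int)
    qed (use \<open>n \<noteq> 0\<close> in auto)
    moreover have "\<mu> \<in> ?O"
    proof -
      have "\<mu> (t n) \<in> topspace X"
        using \<mu>(2) t(2) path_finish_in_topspace[of X \<mu>] by (simp add: paths_from_def)
      then show ?thesis using \<mu>(1) U V by (auto simp: le_less)
    qed
    moreover have "?O \<subseteq> {\<alpha> \<in> loops_at X x0. \<not> path_homotopic X \<alpha> \<beta>}"
    proof
      fix \<nu> assume \<nu>: "\<nu> \<in> ?O"
      have \<nu>AB: "\<nu> \<in> ?A i" "\<nu> \<in> ?B i" if "i \<in> {1..n}" for i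
        using IntD1[OF INT_D[OF \<nu> that]] IntD2[OF INT_D[OF \<nu> that]] by -
      have \<nu>l: "\<nu> \<in> loops_at X x0" using \<nu>AB(1)[of n] \<open>n \<noteq> 0\<close> by simp
      have \<nu>0: "\<nu> 0 = x0" "\<nu> 1 = x0" "\<mu> 0 = x0" "\<mu> 1 = x0" "pathin X \<nu>"
        using \<nu>l \<mu>(1) by (simp_all add: loops_at_def paths_from_def)
      have \<nu>U: "\<forall>i\<in>{1..n}. \<nu> ` {t (i - 1)..t i} \<subseteq> U i" using \<nu>AB(1) by blast
      have \<nu>V: "\<forall>i\<in>{1..<n}. path_connectedin X (V i) \<and> V i \<subseteq> U i \<inter> U (Suc i) \<and>
          \<nu> (t i) \<in> V i \<and> \<mu> (t i) \<in> V i"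
      proof
        fix i assume i: "i \<in> {1..<n}"
        then have "\<nu> (t i) \<in> V i" using \<nu>AB(2)[of i] by simp
        with V[OF i] show "path_connectedin X (V i) \<and> V i \<subseteq> U i \<inter> U (Suc i) \<and>
          \<nu> (t i) \<in> V i \<and> \<mu> (t i) \<in> V i" by blast
      qed
      have "\<mu> (t 0) = \<nu> 0" "\<mu> (t n) = \<nu> 1" using \<nu>0 t by simp_all
      then have "\<exists>\<gamma>\<in>extensional {0..1}. path_homotopic X \<nu> \<gamma> \<and>
        (\<forall>i\<in>{1..n}. \<gamma> ` {t (i - 1)..t i} \<subseteq> U i) \<and> (\<forall>i\<in>{0..n}. \<gamma> (t i) = \<mu> (t i))"
        by (rule path_homotopic_through_points[where y="\<lambda>i. \<mu> (t i)", OF \<nu>0(5) t \<nu>U \<nu>V])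
      then obtain \<gamma> where \<gamma>: "\<gamma> \<in> extensional {0..1}" "path_homotopic X \<nu> \<gamma>"
        "\<forall>i\<in>{1..n}. \<gamma> ` {t (i - 1)..t i} \<subseteq> U i" "\<forall>i\<in>{0..n}. \<gamma> (t i) = \<mu> (t i)"
        by blast
      have p\<gamma>: "pathin X \<gamma>" by (rule path_homotopic_imp_pathin(2)[OF \<gamma>(2)])
      then have \<gamma>p: "\<gamma> \<in> paths_from X x0" "\<gamma> 1 = \<beta> 1"
        using \<gamma>(1) path_homotopic_endpoints[OF \<gamma>(2)] \<nu>0 \<beta>' by (simp_all add: paths_from_def)
      have "loop_class X x0 (\<gamma> \<cdot>\<^sub>p path_reverse \<beta>) \<notin> {\<one>\<^bsub>fundamental_group X x0\<^esub>}"
        by (rule mp[OF bspec[OF * \<gamma>(1)]]) (intro conjI p\<gamma> \<gamma>(3,4))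
      then have "\<not> path_homotopic X \<gamma> \<beta>"
        using loop_class_concat_reverse_eq_one_iff[OF \<gamma>p(1) \<beta>'(1) \<gamma>p(2)] by simp
      \<comment> \<open>A homotopy from \<open>\<nu>\<close> to \<open>\<beta>\<close> would give
        one from \<open>\<gamma>\<close> to \<open>\<beta>\<close>, as \<open>\<gamma>\<close> is
        homotopic to \<open>\<nu>\<close>.\<close>
      then have "\<not> path_homotopic X \<nu> \<beta>"
        using path_homotopic_trans[OF path_homotopic_sym[OF \<gamma>(2)]] by blast
      with \<nu>l show "\<nu> \<in> {\<alpha> \<in> loops_at X x0. \<not> path_homotopic X \<alpha> \<beta>}" by blast
    qed
    ultimately show "\<exists>T. openin (loop_space X x0) T \<and> \<mu> \<in> T \<and>
        T \<subseteq> {\<alpha> \<in> loops_at X x0. \<not> path_homotopic X \<alpha> \<beta>}"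
      by (intro exI[of _ ?O] conjI)
  qed
qed

theorem theorem10:
  fixes X :: "'a topology" and x0 :: 'a
  assumes "path_connected_space X"
    and "locally_path_connected_space X"
    and "x0 \<in> topspace X"
  shows "homotopically_path_Hausdorff X x0 \<longleftrightarrow> t1_space (pi1_qtop X x0)"
  using homotopically_path_Hausdorff_if_t1[OF _ assms(3)] t1_if_homotopically_path_Hausdorff[OF assms(2)]
  by (rule iffI[rotated])

end
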